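(* Let $\mathsf{T}=(T,e,m)$ be a monad on $\mathbf{Set}$ factoring coherently through $\mathbf{Sup}$, and let $\mathbf{V}$ be a non-trivial unital quantale. Then the Kleisli extension $T_M$ of $T$ is a lax extension of $T$.
   Context: **Monads.** $\mathbf{Sup}$ is the category of complete lattices and maps preserving all suprema. A monad $\mathsf{T}=(T,e,m)$ on $\mathbf{Set}$ factors through $\mathbf{Sup}$ if there is a functor $S:\mathbf{Set}\to\mathbf{Sup}$ whose composite with the forgetful functor is $T$, and such that each $m_X:T^2X\to TX$ underlies a $\mathbf{Sup}$-morphism $STX\to SX$; so each $TX$ is a complete lattice and all $Tf$ and $m_X$ preserve suprema. It factors coherently if moreover for all maps $f,g:X\to TY$, $f\le g$ implies $m_Y\cdot Tf\le m_Y\cdot Tg$ (maps into $TY$ are ordered pointwise). **Matrices.** A unital quantale $\mathbf{V}$ is a complete lattice with an associative operation $\otimes$ preserving suprema in each variable and a two-sided unit $k$; it is non-trivial if $\bot\neq k$. $\mathbf{Mat}(\mathbf{V})$ has sets as objects and as morphisms $r:X\nrightarrow Y$ the maps $r:X\times Y\to\mathbf{V}$ ($\mathbf{V}$-matrices), ordered pointwise. The composite of $r:X\nrightarrow Y$ and $s:Y\nrightarrow Z$ is $(s\cdot r)(x,z)=\bigvee_{y\in Y}r(x,y)\otimes s(y,z)$; identities are $1_X(x,y)=k$ if $x=y$ and $\bot$ otherwise. The transpose is $r^\circ(y,x)=r(x,y)$. A map $f:X\to Y$ is identified with the matrix $f(x,y)=k$ if $f(x)=y$, and $\bot$ otherwise.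 **Lax extensions.** A lax extension $T_M$ of $T$ assigns to each $r:X\nrightarrow Y$ a matrix $T_Mr:TX\nrightarrow TY$, preserves the order on hom-sets, and satisfies $Tf\le T_Mf$, $(Tf)^\circ\le T_M(f^\circ)$ and $T_Ms\cdot T_Mr\le T_M(s\cdot r)$ for all maps $f:X\to Y$ and matrices $r:X\nrightarrow Y$, $s:Y\nrightarrow Z$. **Kleisli extension.** Let $\eta_X:PX\to TX$ ($PX$ the powerset) be $\eta_X(A)=\bigvee\{e_X(x)\mid x\in A\}$. For a $\mathbf{V}$-matrix $r:X\nrightarrow Y$ and $a\in\mathbf{V}$ let $\rho_r^a:Y\to PX$, $\rho_r^a(y)=\{x\in X\mid a\le r(x,y)\}$. The Kleisli extension $T_M$ of $T$ sends $r:X\nrightarrow Y$ to $T_Mr:TX\nrightarrow TY$, $$T_Mr(\mathfrak{x},\mathfrak{y}):=\bigvee\{a\in\mathbf{V}\mid\mathfrak{x}\le m_X\cdot T(\eta_X\cdot\rho_r^a)(\mathfrak{y})\}.$$ *)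

theory Defs
  imports "HOL-Algebra.Complete_Lattice" "HOL-Library.FuncSet"
begin

text \<open>
  HOL has no type of all sets, so the category of sets is rendered relative to a universe: its
  objects are the members of a collection \<open>Ob\<close> of subsets of a type \<open>'u\<close>, and its morphisms from
  \<open>X\<close> to \<open>Y\<close> are \<^emph>\<open>all\<close> maps \<open>X \<rightarrow>\<^sub>E Y\<close> (extensional functions, so that equality of morphisms is
  HOL equality). Nothing is assumed about \<open>Ob\<close>; taking for \<open>Ob\<close> the small subsets of a
  Grothendieck universe gives the category of sets itself.
\<close>

locale set_functor =
  fixes Ob :: "'u set set"
    and T :: "'u set \<Rightarrow> 'u set"
    and Tmap :: "'u set \<Rightarrow> 'u set \<Rightarrow> ('u \<Rightarrow> 'u) \<Rightarrow> 'u \<Rightarrow> 'u"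
  assumes T_obj: "X \<in> Ob \<Longrightarrow> T X \<in> Ob"
    and Tmap_hom: "\<lbrakk>X \<in> Ob; Y \<in> Ob; f \<in> X \<rightarrow>\<^sub>E Y\<rbrakk> \<Longrightarrow> Tmap X Y f \<in> T X \<rightarrow>\<^sub>E T Y"
    and Tmap_id: "X \<in> Ob \<Longrightarrow> Tmap X X (\<lambda>x\<in>X. x) = (\<lambda>t\<in>T X. t)"
    and Tmap_comp: "\<lbrakk>X \<in> Ob; Y \<in> Ob; Z \<in> Ob; f \<in> X \<rightarrow>\<^sub>E Y; g \<in> Y \<rightarrow>\<^sub>E Z\<rbrakk> \<Longrightarrow>
      Tmap X Z (compose X g f) = compose (T X) (Tmap Y Z g) (Tmap X Y f)"

locale set_monad = set_functor Ob T Tmap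
  for Ob :: "'u set set"
    and T :: "'u set \<Rightarrow> 'u set"
    and Tmap :: "'u set \<Rightarrow> 'u set \<Rightarrow> ('u \<Rightarrow> 'u) \<Rightarrow> 'u \<Rightarrow> 'u" +
  fixes e :: "'u set \<Rightarrow> 'u \<Rightarrow> 'u"
    and m :: "'u set \<Rightarrow> 'u \<Rightarrow> 'u"
  assumes e_hom: "X \<in> Ob \<Longrightarrow> e X \<in> X \<rightarrow>\<^sub>E T X"
    and m_hom: "X \<in> Ob \<Longrightarrow> m X \<in> T (T X) \<rightarrow>\<^sub>E T X"
    and e_natural: "\<lbrakk>X \<in> Ob; Y \<in> Ob; f \<in> X \<rightarrow>\<^sub>E Y\<rbrakk> \<Longrightarrow>
      compose X (Tmap X Y f) (e X) = compose X (e Y) f"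
    and m_natural: "\<lbrakk>X \<in> Ob; Y \<in> Ob; f \<in> X \<rightarrow>\<^sub>E Y\<rbrakk> \<Longrightarrow>
      compose (T (T X)) (Tmap X Y f) (m X) =
      compose (T (T X)) (m Y) (Tmap (T X) (T Y) (Tmap X Y f))"
    and m_e_left: "X \<in> Ob \<Longrightarrow> compose (T X) (m X) (e (T X)) = (\<lambda>t\<in>T X. t)"
    and m_e_right: "X \<in> Ob \<Longrightarrow> compose (T X) (m X) (Tmap X (T X) (e X)) = (\<lambda>t\<in>T X. t)"
    and m_assoc: "X \<in> Ob \<Longrightarrow>
      compose (T (T (T X))) (m X) (m (T X)) =
      compose (T (T (T X))) (m X) (Tmap (T (T X)) (T X) (m X))"

text \<open>
  A lifting of \<open>T\<close> along the forgetful functor is determined by its object part \<open>S\<close>, since a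
  lifted morphism has the same underlying map. The predicate \<^const>\<open>sup_pres\<close> includes that its
  source and target are complete lattices.
\<close>

locale factors_through_Sup = set_monad Ob T Tmap e m
  for Ob :: "'u set set"
    and T :: "'u set \<Rightarrow> 'u set"
    and Tmap :: "'u set \<Rightarrow> 'u set \<Rightarrow> ('u \<Rightarrow> 'u) \<Rightarrow> 'u \<Rightarrow> 'u"
    and e :: "'u set \<Rightarrow> 'u \<Rightarrow> 'u"
    and m :: "'u set \<Rightarrow> 'u \<Rightarrow> 'u" +
  fixes S :: "'u set \<Rightarrow> 'u gorder"
  assumes S_carrier: "X \<in> Ob \<Longrightarrow> carrier (S X) = T X"
    and S_complete: "X \<in> Ob \<Longrightarrow> complete_lattice (S X)"
    and Tmap_sup_pres: "\<lbrakk>X \<in> Ob; Y \<in> Ob; f \<in> X \<rightarrow>\<^sub>E Y\<rbrakk> \<Longrightarrow> sup_pres (S X) (S Y) (Tmap X Y f)"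
    and m_sup_pres: "X \<in> Ob \<Longrightarrow> sup_pres (S (T X)) (S X) (m X)"

locale factors_coherently_through_Sup = factors_through_Sup +
  assumes coherent:
    "\<lbrakk>X \<in> Ob; Y \<in> Ob; f \<in> X \<rightarrow>\<^sub>E T Y; g \<in> X \<rightarrow>\<^sub>E T Y; \<forall>x\<in>X. f x \<sqsubseteq>\<^bsub>S Y\<^esub> g x\<rbrakk> \<Longrightarrow>
      \<forall>t\<in>T X. compose (T X) (m Y) (Tmap X (T Y) f) t
              \<sqsubseteq>\<^bsub>S Y\<^esub> compose (T X) (m Y) (Tmap X (T Y) g) t"

locale unital_quantale = monoid tens k
  for tens :: "'v::complete_lattice \<Rightarrow> 'v \<Rightarrow> 'v"
    and k :: 'v +
  assumes tens_Sup_right: "tens a (Sup B) = (SUP b\<in>B. tens a b)"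
    and tens_Sup_left: "tens (Sup A) b = (SUP a\<in>A. tens a b)"

definition mat :: "'u set \<Rightarrow> 'u set \<Rightarrow> ('u \<times> 'u \<Rightarrow> 'v) set"
  where "mat X Y = X \<times> Y \<rightarrow>\<^sub>E UNIV"

definition mat_le ::
    "'u set \<Rightarrow> 'u set \<Rightarrow> ('u \<times> 'u \<Rightarrow> 'v::complete_lattice) \<Rightarrow> ('u \<times> 'u \<Rightarrow> 'v) \<Rightarrow> bool"
  where "mat_le X Y r s \<longleftrightarrow> (\<forall>x\<in>X. \<forall>y\<in>Y. r (x, y) \<le> s (x, y))"

text \<open>The composite of \<open>r\<close> from \<open>X\<close> to \<open>Y\<close> and \<open>s\<close> from \<open>Y\<close> to \<open>Z\<close>, arguments in application order.\<close>

definition mat_comp ::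
    "('v \<Rightarrow> 'v \<Rightarrow> 'v) \<Rightarrow> 'u set \<Rightarrow> 'u set \<Rightarrow> 'u set \<Rightarrow>
     ('u \<times> 'u \<Rightarrow> 'v::complete_lattice) \<Rightarrow> ('u \<times> 'u \<Rightarrow> 'v) \<Rightarrow> 'u \<times> 'u \<Rightarrow> 'v"
  where "mat_comp tens X Y Z s r = (\<lambda>(x, z)\<in>X \<times> Z. SUP y\<in>Y. tens (r (x, y)) (s (y, z)))"

definition mat_transpose :: "'u set \<Rightarrow> 'u set \<Rightarrow> ('u \<times> 'u \<Rightarrow> 'v) \<Rightarrow> 'u \<times> 'u \<Rightarrow> 'v"
  where "mat_transpose X Y r = (\<lambda>(y, x)\<in>Y \<times> X. r (x, y))"

definition mat_of_map ::
    "'v \<Rightarrow> 'u set \<Rightarrow> 'u set \<Rightarrow> ('u \<Rightarrow> 'u) \<Rightarrow> 'u \<times> 'u \<Rightarrow> 'v::complete_lattice"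
  where "mat_of_map k X Y f = (\<lambda>(x, y)\<in>X \<times> Y. if f x = y then k else bot)"

definition lax_extension ::
    "'u set set \<Rightarrow> ('u set \<Rightarrow> 'u set) \<Rightarrow> ('u set \<Rightarrow> 'u set \<Rightarrow> ('u \<Rightarrow> 'u) \<Rightarrow> 'u \<Rightarrow> 'u) \<Rightarrow>
     ('v \<Rightarrow> 'v \<Rightarrow> 'v) \<Rightarrow> 'v \<Rightarrow>
     ('u set \<Rightarrow> 'u set \<Rightarrow> ('u \<times> 'u \<Rightarrow> 'v) \<Rightarrow> 'u \<times> 'u \<Rightarrow> 'v::complete_lattice) \<Rightarrow> bool"
  where "lax_extension Ob T Tmap tens k TM \<longleftrightarrow>
    (\<forall>X\<in>Ob. \<forall>Y\<in>Ob. \<forall>r\<in>mat X Y. TM X Y r \<in> mat (T X) (T Y)) \<and>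
    (\<forall>X\<in>Ob. \<forall>Y\<in>Ob. \<forall>r\<in>mat X Y. \<forall>r'\<in>mat X Y.
       mat_le X Y r r' \<longrightarrow> mat_le (T X) (T Y) (TM X Y r) (TM X Y r')) \<and>
    (\<forall>X\<in>Ob. \<forall>Y\<in>Ob. \<forall>f\<in>X \<rightarrow>\<^sub>E Y.
       mat_le (T X) (T Y) (mat_of_map k (T X) (T Y) (Tmap X Y f)) (TM X Y (mat_of_map k X Y f))) \<and>
    (\<forall>X\<in>Ob. \<forall>Y\<in>Ob. \<forall>f\<in>X \<rightarrow>\<^sub>E Y.
       mat_le (T Y) (T X)
         (mat_transpose (T X) (T Y) (mat_of_map k (T X) (T Y) (Tmap X Y f)))
         (TM Y X (mat_transpose X Y (mat_of_map k X Y f)))) \<and>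
    (\<forall>X\<in>Ob. \<forall>Y\<in>Ob. \<forall>Z\<in>Ob. \<forall>r\<in>mat X Y. \<forall>s\<in>mat Y Z.
       mat_le (T X) (T Z)
         (mat_comp tens (T X) (T Y) (T Z) (TM Y Z s) (TM X Y r))
         (TM X Z (mat_comp tens X Y Z s r)))"

definition eta :: "('u set \<Rightarrow> 'u gorder) \<Rightarrow> ('u set \<Rightarrow> 'u \<Rightarrow> 'u) \<Rightarrow> 'u set \<Rightarrow> 'u set \<Rightarrow> 'u"
  where "eta S e X = (\<lambda>A\<in>Pow X. \<Squnion>\<^bsub>S X\<^esub> {e X x |x. x \<in> A})"

definition rho ::
    "'u set \<Rightarrow> 'u set \<Rightarrow> ('u \<times> 'u \<Rightarrow> 'v::complete_lattice) \<Rightarrow> 'v \<Rightarrow> 'u \<Rightarrow> 'u set"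
  where "rho X Y r a = (\<lambda>y\<in>Y. {x \<in> X. a \<le> r (x, y)})"

definition kleisli_extension ::
    "('u set \<Rightarrow> 'u set) \<Rightarrow> ('u set \<Rightarrow> 'u set \<Rightarrow> ('u \<Rightarrow> 'u) \<Rightarrow> 'u \<Rightarrow> 'u) \<Rightarrow>
     ('u set \<Rightarrow> 'u \<Rightarrow> 'u) \<Rightarrow> ('u set \<Rightarrow> 'u \<Rightarrow> 'u) \<Rightarrow> ('u set \<Rightarrow> 'u gorder) \<Rightarrow>
     'u set \<Rightarrow> 'u set \<Rightarrow> ('u \<times> 'u \<Rightarrow> 'v) \<Rightarrow> 'u \<times> 'u \<Rightarrow> 'v::complete_lattice"
  where "kleisli_extension T Tmap e m S X Y r =
    (\<lambda>(p, q)\<in>T X \<times> T Y.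
       Sup {a. p \<sqsubseteq>\<^bsub>S X\<^esub>
         compose (T Y) (m X) (Tmap Y (T X) (compose Y (eta S e X) (rho X Y r a))) q})"

end

theory Submission
  imports Defs
begin

text \<open>
  Writing \<open>g*\<close> for the Kleisli lifting \<open>m \<cdot> T g\<close> and \<open>r\<^sup>a\<close> for \<open>\<eta> \<cdot> \<rho>\<^sub>r\<^sup>a\<close>, an element \<open>a\<close>
  contributes to \<open>T\<^sub>M r (p, q)\<close> iff \<open>p \<le> (r\<^sup>a)* q\<close>. Coherence turns each lax extension axiom into
  a pointwise inequality of Kleisli arrows: \<open>e \<le> f\<^sup>k \<cdot> f\<close> and \<open>e \<cdot> f \<le> (f\<^sup>\<circ>)\<^sup>k\<close> give the two axioms
  for maps, and \<open>(r\<^sup>a)* \<cdot> s\<^sup>b \<le> (s \<cdot> r)\<^sup>c\<close> for \<open>c = a \<otimes> b\<close>, which holds because \<open>(r\<^sup>a)*\<close> preserves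
  suprema and \<open>(r\<^sup>a)* \<cdot> e = r\<^sup>a\<close>, gives the axiom for composites.
\<close>

section \<open>Maps that preserve suprema\<close>

lemma sup_presD:
  assumes "sup_pres X Y f" "A \<subseteq> carrier X"
  shows "f (\<Squnion>\<^bsub>X\<^esub> A) = \<Squnion>\<^bsub>Y\<^esub> (f ` A)"
  using assms by (simp add: sup_pres_def)

lemma sup_pres_compose:
  assumes "sup_pres X Y f" "sup_pres Y Z g" "f \<in> carrier X \<rightarrow> carrier Y"
  shows "sup_pres X Z (compose (carrier X) g f)"
proof -
  interpret X: complete_lattice X
    using assms(1) by (simp add: sup_pres_def)
  have "compose (carrier X) g f (\<Squnion>\<^bsub>X\<^esub> A) = \<Squnion>\<^bsub>Z\<^esub> (compose (carrier X) g f ` A)"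
    if A: "A \<subseteq> carrier X" for A
  proof -
    have "f ` A \<subseteq> carrier Y"
      using A assms(3) by auto
    moreover have "compose (carrier X) g f ` A = g ` f ` A"
      using A by (auto simp: compose_def image_iff subset_iff)
    ultimately show ?thesis
      using A assms(1,2) by (simp add: compose_eq sup_presD)
  qed
  with assms(1,2) show ?thesis
    by (simp add: sup_pres_def)
qed

text \<open>Preserving all suprema includes binary joins, and joins determine the order:
  \<open>x\<close> lies below \<open>y\<close> iff their join is \<open>y\<close>.\<close>

lemma sup_pres_mono:
  assumes f: "sup_pres X Y f" "f \<in> carrier X \<rightarrow> carrier Y"
    and xy: "x \<in> carrier X" "y \<in> carrier X" "x \<sqsubseteq>\<^bsub>X\<^esub> y"
  shows "f x \<sqsubseteq>\<^bsub>Y\<^esub> f y"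
  by (rule use_iso2[OF join_pres_isotone[OF f(2) sup_pres_is_join_pres[OF weak_sup_pres[OF f(1)]]] xy])

section \<open>The Kleisli lifting and its laws\<close>

context set_monad
begin

text \<open>This is \<open>g*\<close> of the outline above. The argument \<open>Y\<close> is the set
  under the target \<open>T Y\<close>, not the target itself.\<close>

definition bind :: "'u set \<Rightarrow> 'u set \<Rightarrow> ('u \<Rightarrow> 'u) \<Rightarrow> 'u \<Rightarrow> 'u"
  where "bind X Y f = compose (T X) (m Y) (Tmap X (T Y) f)"

context
  fixes X Y assumes X: "X \<in> Ob" and Y: "Y \<in> Ob"
begin

lemma bind_hom:
  assumes "f \<in> X \<rightarrow>\<^sub>E T Y"
  shows "bind X Y f \<in> T X \<rightarrow>\<^sub>E T Y"
  using Tmap_hom[OF X T_obj[OF Y] assms] m_hom[OF Y]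
  by (auto simp: bind_def compose_def PiE_iff)

lemma bind_closed:
  assumes "f \<in> X \<rightarrow>\<^sub>E T Y" "t \<in> T X"
  shows "bind X Y f t \<in> T Y"
  using bind_hom[OF assms(1)] assms(2) by auto

text \<open>Naturality of \<open>e\<close> moves \<open>f\<close> inside the unit, which
  \<open>m_e_left\<close> then cancels.\<close>

lemma bind_e:
  assumes f: "f \<in> X \<rightarrow>\<^sub>E T Y" and x: "x \<in> X"
  shows "bind X Y f (e X x) = f x"
proof -
  have ex: "e X x \<in> T X" and fx: "f x \<in> T Y"
    using e_hom[OF X] f x by auto
  have "bind X Y f (e X x) = m Y (e (T Y) (f x))"
    using fun_cong[OF e_natural[OF X T_obj[OF Y] f], of x] x ex
    by (simp add: bind_def compose_eq)
  also have "\<dots> = f x"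
    using fun_cong[OF m_e_left[OF Y], of "f x"] fx by (simp add: compose_eq)
  finally show ?thesis .
qed

text \<open>Functoriality of \<open>T\<close>. It turns a comparison of Kleisli arrows
  \<open>g \<cdot> f\<close> into one that involves \<open>T f\<close>.\<close>

lemma bind_compose:
  assumes Z: "Z \<in> Ob" and f: "f \<in> X \<rightarrow>\<^sub>E Y" and g: "g \<in> Y \<rightarrow>\<^sub>E T Z" and t: "t \<in> T X"
  shows "bind X Z (compose X g f) t = bind Y Z g (Tmap X Y f t)"
proof -
  have "Tmap X Y f t \<in> T Y"
    using Tmap_hom[OF X Y f] t by auto
  then show ?thesis
    using t by (simp add: bind_def compose_eq Tmap_comp[OF X Y T_obj[OF Z] f g])
qed

text \<open>The unit law \<open>m_e_right\<close> exhibits \<open>T f\<close> as a Kleisli lifting,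
  so that coherence can be applied to it.\<close>

lemma bind_e_compose:
  assumes f: "f \<in> X \<rightarrow>\<^sub>E Y" and t: "t \<in> T X"
  shows "bind X Y (compose X (e Y) f) t = Tmap X Y f t"
proof -
  have "Tmap X Y f t \<in> T Y"
    using Tmap_hom[OF X Y f] t by auto
  then show ?thesis
    using fun_cong[OF m_e_right[OF Y], of "Tmap X Y f t"]
    unfolding bind_compose[OF Y f e_hom[OF Y] t] by (simp add: bind_def compose_eq)
qed

text \<open>Associativity of Kleisli composition, from naturality of \<open>m\<close>, then
  \<open>m_assoc\<close>, then functoriality.\<close>

lemma bind_bind:
  assumes Z: "Z \<in> Ob" and f: "f \<in> X \<rightarrow>\<^sub>E T Y" and g: "g \<in> Y \<rightarrow>\<^sub>E T Z" and t: "t \<in> T X"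
  shows "bind Y Z g (bind X Y f t) = bind X Z (compose X (bind Y Z g) f) t"
proof -
  note TY = T_obj[OF Y] and TZ = T_obj[OF Z]
  have Tg: "Tmap Y (T Z) g \<in> T Y \<rightarrow>\<^sub>E T (T Z)"
    by (rule Tmap_hom[OF Y TZ g])
  define u where "u = Tmap X (T Y) f t"
  have u: "u \<in> T (T Y)"
    using Tmap_hom[OF X TY f] t by (auto simp: u_def)
  then have mu: "m Y u \<in> T Y"
    using m_hom[OF Y] by auto
  define w where "w = Tmap (T Y) (T (T Z)) (Tmap Y (T Z) g) u"
  have w: "w \<in> T (T (T Z))"
    using Tmap_hom[OF TY T_obj[OF TZ] Tg] u by (auto simp: w_def)
  have "bind Y Z g (bind X Y f t) = m Z (Tmap Y (T Z) g (m Y u))"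
    using t mu by (simp add: bind_def compose_eq u_def)
  also have "\<dots> = m Z (m (T Z) w)"
    using fun_cong[OF m_natural[OF Y TZ g], of u] u by (simp add: compose_eq w_def)
  also have "\<dots> = m Z (Tmap (T (T Z)) (T Z) (m Z) w)"
    using fun_cong[OF m_assoc[OF Z], of w] w by (simp add: compose_eq)
  also have "\<dots> = m Z (Tmap (T Y) (T Z) (bind Y Z g) u)"
    using u by (simp add: w_def bind_def compose_eq Tmap_comp[OF TY T_obj[OF TZ] TZ Tg m_hom[OF Z]])
  also have "\<dots> = bind X Z (compose X (bind Y Z g) f) t"
  proof -
    have "bind Y Z g \<in> T Y \<rightarrow>\<^sub>E T Z"
      using Tg m_hom[OF Z] by (auto simp: bind_def compose_def PiE_iff)
    then show ?thesis
      using t by (simp add: u_def bind_def[of X Z] compose_eq Tmap_comp[OF X TY TZ f])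
  qed
  finally show ?thesis .
qed

end

end

section \<open>Kleisli arrows of a matrix and the order on \<open>T X\<close>\<close>

context factors_through_Sup
begin

text \<open>This is \<open>r\<^sup>a\<close> of the outline. It runs from \<open>Y\<close> to
  \<open>T X\<close>, against the direction of \<open>r\<close>.\<close>

definition kleisli_arrow ::
    "'u set \<Rightarrow> 'u set \<Rightarrow> ('u \<times> 'u \<Rightarrow> 'v::complete_lattice) \<Rightarrow> 'v \<Rightarrow> 'u \<Rightarrow> 'u"
  where "kleisli_arrow X Y r a = compose Y (eta S e X) (rho X Y r a)"

lemma kleisli_arrow_eq:
  assumes "y \<in> Y"
  shows "kleisli_arrow X Y r a y = \<Squnion>\<^bsub>S X\<^esub> {e X x |x. x \<in> X \<and> a \<le> r (x, y)}"
  using assms by (simp add: kleisli_arrow_def compose_eq eta_def rho_def Pow_def)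

lemma kleisli_extension_eq:
  assumes "p \<in> T X" "q \<in> T Y"
  shows "kleisli_extension T Tmap e m S X Y r (p, q) =
    Sup {a. p \<sqsubseteq>\<^bsub>S X\<^esub> bind Y X (kleisli_arrow X Y r a) q}"
  using assms by (simp add: kleisli_extension_def bind_def kleisli_arrow_def)

lemma kleisli_extension_ge:
  assumes "p \<in> T X" "q \<in> T Y" "p \<sqsubseteq>\<^bsub>S X\<^esub> bind Y X (kleisli_arrow X Y r a) q"
  shows "a \<le> kleisli_extension T Tmap e m S X Y r (p, q)"
  using assms by (auto simp: kleisli_extension_eq intro: Sup_upper)

context
  fixes X assumes X: "X \<in> Ob"
begin

interpretation complete_lattice "S X"
  rewrites "carrier (S X) = T X"
  by (simp_all add: S_complete S_carrier X)

text \<open>Makes transitivity available after the enclosing context, where the interpretation of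
  \<open>S X\<close> ends.\<close>

lemma le_transitive:
  "p \<sqsubseteq>\<^bsub>S X\<^esub> q \<Longrightarrow> q \<sqsubseteq>\<^bsub>S X\<^esub> w \<Longrightarrow> p \<in> T X \<Longrightarrow> q \<in> T X \<Longrightarrow> w \<in> T X \<Longrightarrow> p \<sqsubseteq>\<^bsub>S X\<^esub> w"
  by (rule le_trans)

lemma Sup_le:
  assumes "A \<subseteq> T X" "w \<in> T X" "\<And>p. p \<in> A \<Longrightarrow> p \<sqsubseteq>\<^bsub>S X\<^esub> w"
  shows "\<Squnion>\<^bsub>S X\<^esub> A \<sqsubseteq>\<^bsub>S X\<^esub> w"
  using assms by (intro sup_least) (auto simp: Upper_def S_carrier X)

lemma kleisli_arrow_hom: "kleisli_arrow X Y r a \<in> Y \<rightarrow>\<^sub>E T X"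
proof (rule PiE_I)
  fix y assume "y \<in> Y"
  moreover have "{e X x |x. x \<in> X \<and> a \<le> r (x, y)} \<subseteq> T X"
    using e_hom[OF X] by auto
  ultimately show "kleisli_arrow X Y r a y \<in> T X"
    by (simp add: kleisli_arrow_eq sup_closed)
qed (simp add: kleisli_arrow_def compose_def)

text \<open>Together with \<open>kleisli_arrow_least\<close> this is the universal property of the
  supremum, through which Kleisli arrows are compared pointwise.\<close>

lemma kleisli_arrow_upper:
  assumes "x \<in> X" "y \<in> Y" "a \<le> r (x, y)"
  shows "e X x \<sqsubseteq>\<^bsub>S X\<^esub> kleisli_arrow X Y r a y"
  unfolding kleisli_arrow_eq[OF assms(2)]
  using assms e_hom[OF X] by (intro sup_upper) (auto simp: S_carrier X)

lemma kleisli_arrow_least: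
  assumes "y \<in> Y" "w \<in> T X" "\<And>x. x \<in> X \<Longrightarrow> a \<le> r (x, y) \<Longrightarrow> e X x \<sqsubseteq>\<^bsub>S X\<^esub> w"
  shows "kleisli_arrow X Y r a y \<sqsubseteq>\<^bsub>S X\<^esub> w"
  unfolding kleisli_arrow_eq[OF assms(1)]
  using assms e_hom[OF X] by (intro Sup_le) auto

end

lemma bind_sup_pres:
  assumes X: "X \<in> Ob" and Y: "Y \<in> Ob" and f: "f \<in> X \<rightarrow>\<^sub>E T Y"
  shows "sup_pres (S X) (S Y) (bind X Y f)"
proof -
  note TY = T_obj[OF Y]
  have "Tmap X (T Y) f \<in> carrier (S X) \<rightarrow> carrier (S (T Y))"
    using Tmap_hom[OF X TY f] by (simp add: S_carrier X TY PiE_iff)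
  then show ?thesis
    using sup_pres_compose[OF Tmap_sup_pres[OF X TY f] m_sup_pres[OF Y]]
    by (simp add: bind_def S_carrier X)
qed

lemma bind_mono:
  assumes X: "X \<in> Ob" and Y: "Y \<in> Ob" and f: "f \<in> X \<rightarrow>\<^sub>E T Y"
    and "p \<in> T X" "q \<in> T X" "p \<sqsubseteq>\<^bsub>S X\<^esub> q"
  shows "bind X Y f p \<sqsubseteq>\<^bsub>S Y\<^esub> bind X Y f q"
  using assms bind_hom[OF X Y f]
  by (intro sup_pres_mono[OF bind_sup_pres[OF X Y f]]) (auto simp: S_carrier)

end

section \<open>Monotonicity of the extension and its axioms for maps\<close>

context factors_coherently_through_Sup
begin

text \<open>Monotonicity of the lifting in the arrow, where \<open>bind_mono\<close> gives it in the
  argument. The assumption \<open>coherent\<close> enters the proof only here.\<close>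

lemma bind_coherent:
  assumes "X \<in> Ob" "Y \<in> Ob" "f \<in> X \<rightarrow>\<^sub>E T Y" "g \<in> X \<rightarrow>\<^sub>E T Y"
    and "\<And>x. x \<in> X \<Longrightarrow> f x \<sqsubseteq>\<^bsub>S Y\<^esub> g x" and "t \<in> T X"
  shows "bind X Y f t \<sqsubseteq>\<^bsub>S Y\<^esub> bind X Y g t"
  using coherent[of X Y f g] assms by (simp add: bind_def)

text \<open>A larger matrix has larger sets \<open>rho X Y r a\<close>, hence larger Kleisli arrows
  and, by coherence, larger liftings. So every \<open>a\<close> that counts for \<open>r\<close>
  counts for \<open>r'\<close>.\<close>

lemma kleisli_extension_mono:
  assumes X: "X \<in> Ob" and Y: "Y \<in> Ob" and r: "mat_le X Y r r'"
  shows "mat_le (T X) (T Y)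
    (kleisli_extension T Tmap e m S X Y r) (kleisli_extension T Tmap e m S X Y r')"
  unfolding mat_le_def
proof (intro ballI)
  fix p q assume p: "p \<in> T X" and q: "q \<in> T Y"
  note hom = kleisli_arrow_hom[OF X, of Y]
  have "kleisli_arrow X Y r a y \<sqsubseteq>\<^bsub>S X\<^esub> kleisli_arrow X Y r' a y" if y: "y \<in> Y" for a y
    using r y PiE_mem[OF hom y]
    by (intro kleisli_arrow_least[OF X y] kleisli_arrow_upper[OF X])
      (auto simp: mat_le_def intro: order_trans)
  then have step: "bind Y X (kleisli_arrow X Y r a) q \<sqsubseteq>\<^bsub>S X\<^esub> bind Y X (kleisli_arrow X Y r' a) q" for a
    using bind_coherent[OF Y X hom hom _ q] by blast
  show "kleisli_extension T Tmap e m S X Y r (p, q) \<le> kleisli_extension T Tmap e m S X Y r' (p, q)"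
    unfolding kleisli_extension_eq[OF p q, of r]
  proof (intro Sup_least, elim CollectE)
    fix a assume "p \<sqsubseteq>\<^bsub>S X\<^esub> bind Y X (kleisli_arrow X Y r a) q"
    then have "p \<sqsubseteq>\<^bsub>S X\<^esub> bind Y X (kleisli_arrow X Y r' a) q"
      by (rule le_transitive[OF X _ step p bind_closed[OF Y X hom q] bind_closed[OF Y X hom q]])
    then show "a \<le> kleisli_extension T Tmap e m S X Y r' (p, q)"
      by (rule kleisli_extension_ge[OF p q])
  qed
qed

text \<open>The point \<open>x\<close> lies in the fibre of \<open>f\<close> over
  \<open>f x\<close>, so \<open>e \<le> f\<^sup>k \<cdot> f\<close>. Lifting both sides gives
  \<open>p \<le> (f\<^sup>k)* (T f p)\<close>, because \<open>e*\<close> is the identity.\<close>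

lemma Tmap_le_kleisli_extension:
  assumes X: "X \<in> Ob" and Y: "Y \<in> Ob" and f: "f \<in> X \<rightarrow>\<^sub>E Y"
  shows "mat_le (T X) (T Y) (mat_of_map k (T X) (T Y) (Tmap X Y f))
    (kleisli_extension T Tmap e m S X Y (mat_of_map k X Y f))"
proof -
  let ?g = "kleisli_arrow X Y (mat_of_map k X Y f) k"
  have g: "?g \<in> Y \<rightarrow>\<^sub>E T X"
    by (rule kleisli_arrow_hom[OF X])
  have gf: "compose X ?g f \<in> X \<rightarrow>\<^sub>E T X"
    using f g by (auto simp: compose_def PiE_iff)
  \<comment> \<open>Off the graph of \<open>T f\<close> the left-hand matrix is \<open>bot\<close>.
    On the graph it is \<open>k\<close>, and \<open>k\<close> itself is shown to occur in the
    supremum.\<close>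
  have "k \<le> kleisli_extension T Tmap e m S X Y (mat_of_map k X Y f) (p, Tmap X Y f p)"
    if p: "p \<in> T X" for p
  proof -
    have "bind X X (e X) p \<sqsubseteq>\<^bsub>S X\<^esub> bind X X (compose X ?g f) p"
      using f by (intro bind_coherent[OF X X e_hom[OF X] gf _ p])
        (auto simp: compose_eq mat_of_map_def PiE_iff intro!: kleisli_arrow_upper[OF X])
    moreover have "bind X X (e X) p = p"
      using fun_cong[OF m_e_right[OF X], of p] p by (simp add: bind_def)
    ultimately have "p \<sqsubseteq>\<^bsub>S X\<^esub> bind Y X ?g (Tmap X Y f p)"
      by (simp add: bind_compose[OF X Y X f g p])
    then show ?thesis
      using Tmap_hom[OF X Y f] p by (intro kleisli_extension_ge) auto
  qed
  then show ?thesis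
    by (auto simp: mat_le_def mat_of_map_def)
qed

text \<open>Here \<open>f x\<close> is one of the points \<open>y\<close> with
  \<open>k \<le> ?r (y, x)\<close>, so \<open>e \<cdot> f\<close> lies below the Kleisli arrow of
  the transpose at \<open>k\<close>.\<close>

lemma Tmap_transpose_le_kleisli_extension:
  assumes X: "X \<in> Ob" and Y: "Y \<in> Ob" and f: "f \<in> X \<rightarrow>\<^sub>E Y"
  shows "mat_le (T Y) (T X)
    (mat_transpose (T X) (T Y) (mat_of_map k (T X) (T Y) (Tmap X Y f)))
    (kleisli_extension T Tmap e m S Y X (mat_transpose X Y (mat_of_map k X Y f)))"
proof -
  let ?r = "mat_transpose X Y (mat_of_map k X Y f)"
  have ef: "compose X (e Y) f \<in> X \<rightarrow>\<^sub>E T Y"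
    using f e_hom[OF Y] by (auto simp: compose_def PiE_iff)
  have "k \<le> kleisli_extension T Tmap e m S Y X ?r (Tmap X Y f p, p)" if p: "p \<in> T X" for p
  proof -
    have "bind X Y (compose X (e Y) f) p \<sqsubseteq>\<^bsub>S Y\<^esub> bind X Y (kleisli_arrow Y X ?r k) p"
      using f by (intro bind_coherent[OF X Y ef kleisli_arrow_hom[OF Y] _ p])
        (auto simp: compose_eq mat_transpose_def mat_of_map_def PiE_iff
          intro!: kleisli_arrow_upper[OF Y])
    then have "Tmap X Y f p \<sqsubseteq>\<^bsub>S Y\<^esub> bind X Y (kleisli_arrow Y X ?r k) p"
      by (simp add: bind_e_compose[OF X Y f p])
    then show ?thesis
      using Tmap_hom[OF X Y f] p by (intro kleisli_extension_ge) auto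
  qed
  then show ?thesis
    by (auto simp: mat_le_def mat_transpose_def mat_of_map_def)
qed

end

section \<open>Quantales and the axiom for composites\<close>

context unital_quantale
begin

text \<open>If \<open>a \<le> a'\<close> then \<open>a'\<close> is the supremum of the pair, so
  preservation of suprema in each variable gives monotonicity.\<close>

lemma tens_mono:
  assumes "a \<le> a'" "b \<le> b'"
  shows "tens a b \<le> tens a' b'"
proof -
  have "tens a b \<le> tens (Sup {a, a'}) b"
    unfolding tens_Sup_left by (rule SUP_upper) simp
  also have "\<dots> = tens a' b"
    using assms by (simp add: sup_absorb2)
  also have "\<dots> \<le> tens a' (Sup {b, b'})"
    unfolding tens_Sup_right by (rule SUP_upper) simp
  also have "\<dots> = tens a' b'"
    using assms by (simp add: sup_absorb2)
  finally show ?thesis .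
qed

lemma mat_comp_ge:
  assumes "x \<in> X" "y \<in> Y" "z \<in> Z" "a \<le> r (x, y)" "b \<le> s (y, z)"
  shows "tens a b \<le> mat_comp tens X Y Z s r (x, z)"
  using assms by (auto simp: mat_comp_def intro!: SUP_upper2[where i = y] tens_mono)

end

text \<open>The left side unfolds to a supremum of values \<open>r\<^sup>a y\<close> with
  \<open>b \<le> s (y, z)\<close>, each in turn a supremum of \<open>e x\<close> with
  \<open>a \<le> r (x, y)\<close>. Such an \<open>x\<close> occurs on the right, with
  \<open>y\<close> as witness for the composite.\<close>

lemma (in factors_coherently_through_Sup) bind_kleisli_arrow_le:
  assumes "unital_quantale tens k" and X: "X \<in> Ob" and Y: "Y \<in> Ob" and z: "z \<in> Z"
  shows "bind Y X (kleisli_arrow X Y r a) (kleisli_arrow Y Z s b z)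
    \<sqsubseteq>\<^bsub>S X\<^esub> kleisli_arrow X Z (mat_comp tens X Y Z s r) (tens a b) z"
    (is "_ \<sqsubseteq>\<^bsub>S X\<^esub> ?w")
proof -
  interpret unital_quantale tens k by fact
  let ?E = "{e Y y |y. y \<in> Y \<and> b \<le> s (y, z)}"
  note hom = kleisli_arrow_hom[OF X, of Y r a]
  have w: "?w \<in> T X"
    using kleisli_arrow_hom[OF X] z by auto
  have E: "?E \<subseteq> carrier (S Y)"
    using e_hom[OF Y] by (auto simp: S_carrier Y)
  have "bind Y X (kleisli_arrow X Y r a) (kleisli_arrow Y Z s b z)
      = \<Squnion>\<^bsub>S X\<^esub> (bind Y X (kleisli_arrow X Y r a) ` ?E)"
    unfolding kleisli_arrow_eq[OF z, of Y] by (rule sup_presD[OF bind_sup_pres[OF Y X hom] E])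
  moreover have "\<Squnion>\<^bsub>S X\<^esub> (bind Y X (kleisli_arrow X Y r a) ` ?E) \<sqsubseteq>\<^bsub>S X\<^esub> ?w"
  proof (rule Sup_le[OF X _ w])
    show "bind Y X (kleisli_arrow X Y r a) ` ?E \<subseteq> T X"
      using E bind_hom[OF Y X hom] by (auto simp: S_carrier Y)
    fix p assume "p \<in> bind Y X (kleisli_arrow X Y r a) ` ?E"
    then obtain y where y: "y \<in> Y" "b \<le> s (y, z)" and p: "p = kleisli_arrow X Y r a y"
      by (auto simp: bind_e[OF Y X hom])
    show "p \<sqsubseteq>\<^bsub>S X\<^esub> ?w"
      unfolding p
      by (intro kleisli_arrow_least[OF X y(1) w] kleisli_arrow_upper[OF X _ z]
          mat_comp_ge[where y = y] y z)
  qed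
  ultimately show ?thesis
    by simp
qed

lemma (in factors_coherently_through_Sup) kleisli_extension_comp:
  assumes quantale: "unital_quantale tens k" and X: "X \<in> Ob" and Y: "Y \<in> Ob" and Z: "Z \<in> Ob"
  shows "mat_le (T X) (T Z)
    (mat_comp tens (T X) (T Y) (T Z)
      (kleisli_extension T Tmap e m S Y Z s) (kleisli_extension T Tmap e m S X Y r))
    (kleisli_extension T Tmap e m S X Z (mat_comp tens X Y Z s r))"
    (is "mat_le _ _ _ ?K")
  unfolding mat_le_def
proof (intro ballI)
  fix p w assume p: "p \<in> T X" and w: "w \<in> T Z"
  interpret unital_quantale tens k by fact
  \<comment> \<open>Because \<open>tens\<close> distributes over the two defining suprema, single
    elements \<open>a\<close>, \<open>b\<close> and a single middle point \<open>q\<close>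
    suffice.\<close>
  have "tens a b \<le> ?K (p, w)"
    if q: "q \<in> T Y" and a: "p \<sqsubseteq>\<^bsub>S X\<^esub> bind Y X (kleisli_arrow X Y r a) q"
      and b: "q \<sqsubseteq>\<^bsub>S Y\<^esub> bind Z Y (kleisli_arrow Y Z s b) w" for q a b
  proof -
    let ?f = "kleisli_arrow X Y r a" and ?g = "kleisli_arrow Y Z s b"
    let ?h = "kleisli_arrow X Z (mat_comp tens X Y Z s r) (tens a b)"
    have f: "?f \<in> Y \<rightarrow>\<^sub>E T X" and g: "?g \<in> Z \<rightarrow>\<^sub>E T Y" and h: "?h \<in> Z \<rightarrow>\<^sub>E T X"
      by (simp_all add: kleisli_arrow_hom X Y)
    have fg: "compose Z (bind Y X ?f) ?g \<in> Z \<rightarrow>\<^sub>E T X"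
      using bind_hom[OF Y X f] g by (auto simp: compose_def PiE_iff)
    note gw = bind_closed[OF Z Y g w]
    \<comment> \<open>The chain is
      \<open>p \<le> f* q \<le> f* (g* w) = (f* \<cdot> g)* w \<le> h* w\<close>, whose last step is
      coherence applied to \<open>bind_kleisli_arrow_le\<close>.\<close>
    have "bind Y X ?f q \<sqsubseteq>\<^bsub>S X\<^esub> bind Y X ?f (bind Z Y ?g w)"
      by (rule bind_mono[OF Y X f q gw b])
    with a have "p \<sqsubseteq>\<^bsub>S X\<^esub> bind Y X ?f (bind Z Y ?g w)"
      by (rule le_transitive[OF X]) (intro p bind_closed[OF Y X f] q gw)+
    then have "p \<sqsubseteq>\<^bsub>S X\<^esub> bind Z X (compose Z (bind Y X ?f) ?g) w"
      unfolding bind_bind[OF Z Y X g f w] .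
    moreover have "bind Z X (compose Z (bind Y X ?f) ?g) w \<sqsubseteq>\<^bsub>S X\<^esub> bind Z X ?h w"
      by (rule bind_coherent[OF Z X fg h _ w])
        (simp add: compose_eq bind_kleisli_arrow_le[OF quantale X Y])
    ultimately have "p \<sqsubseteq>\<^bsub>S X\<^esub> bind Z X ?h w"
      by (rule le_transitive[OF X]) (intro p bind_closed[OF Z X] fg h w)+
    then show ?thesis
      by (rule kleisli_extension_ge[OF p w])
  qed
  then show "mat_comp tens (T X) (T Y) (T Z)
      (kleisli_extension T Tmap e m S Y Z s) (kleisli_extension T Tmap e m S X Y r) (p, w)
      \<le> ?K (p, w)"
    using p w
    by (auto simp: mat_comp_def kleisli_extension_eq tens_Sup_left tens_Sup_right
        intro!: SUP_least)
qed

theorem proposition3p2: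
  fixes Ob :: "'u set set"
    and T :: "'u set \<Rightarrow> 'u set"
    and Tmap :: "'u set \<Rightarrow> 'u set \<Rightarrow> ('u \<Rightarrow> 'u) \<Rightarrow> 'u \<Rightarrow> 'u"
    and e m :: "'u set \<Rightarrow> 'u \<Rightarrow> 'u"
    and S :: "'u set \<Rightarrow> 'u gorder"
    and tens :: "'v::complete_lattice \<Rightarrow> 'v \<Rightarrow> 'v"
    and k :: 'v
  assumes "factors_coherently_through_Sup Ob T Tmap e m S"
    and "unital_quantale tens k"
    and "(bot :: 'v) \<noteq> k"
  shows "lax_extension Ob T Tmap tens k (kleisli_extension T Tmap e m S)"
proof -
  interpret factors_coherently_through_Sup Ob T Tmap e m S by fact
  \<comment> \<open>The typing clause holds since the extension is by definition a restricted
    function; the other four clauses are the preceding lemmas.\<close>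
  have "kleisli_extension T Tmap e m S X Y r \<in> mat (T X) (T Y)"
    for X Y and r :: "'u \<times> 'u \<Rightarrow> 'v"
    by (simp add: kleisli_extension_def mat_def)
  then show ?thesis
    unfolding lax_extension_def
    by (intro conjI ballI impI kleisli_extension_mono Tmap_le_kleisli_extension
        Tmap_transpose_le_kleisli_extension kleisli_extension_comp[OF assms(2)])
qed

end
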